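(* Let $v,w\in S_n$. If $S\subseteq D(v)$ is not a face of the pipe complex $\Delta_{v,w}$, then the monomial $\prod_{(i,j)\in S}z_{ij}\in\mathbb{C}[\mathbf{z}^{(v)}]$ is divisible by the $\prec$-leading term of one of the essential minors of $I_{v,w}$.
   Context: $w_0$ is the longest element of $S_n$, $s_k=(k\leftrightarrow k+1)$, $\ell$ is length. Positions $(i,j)$: row $i$ from the bottom, column $j$ from the left. For $v\in S_n$, $Z^{(v)}$ has entry $1$ at $(n-v(j)+1,j)$, entries $0$ at $(n-v(j)+1,a)$, $a>j$, and at $(b,j)$, $b>n-v(j)+1$, and distinct indeterminates $z_{ij}$ elsewhere, forming $\mathbf{z}^{(v)}$; their positions form the Rothe diagram $D(v)=\{(i,j): i<n-v(j)+1,\ j<v^{-1}(n-i+1)\}$. With $r^w_{ij}=\#\{k\le j: w(k)\ge n-i+1\}$ and $Z^{(v)}_{ij}$ the submatrix of bottom $i$ rows and leftmost $j$ columns, the essential minors of $I_{v,w}$ are the minors of size $1+r^w_{ij}$ of $Z^{(v)}_{ij}$ for $(i,j)$ in the essential set $\mathcal{E}(w)=\{(i,j)\in D(w):(i+1,j)\notin D(w),(i,j+1)\notin D(w)\}$. The term order $\prec$ is lexicographic with $z_{ij}\prec z_{kl}$ iff $j<l$, or $j=l$ and $i>k$. Canonical labeling: the $t$ boxes of row $i$ of $D(v)$ get labels $i,\dots,i+t-1$ left to right; reading order rows top to bottom, left to right; the Demazure product of labels $a_1,\dots,a_m$ is $\delta(\emptyset)=\mathrm{id}$, $\delta(a_1..a_m)=\delta(a_1..a_{m-1})s_{a_m}$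 if this increases length, else $\delta(a_1..a_{m-1})$. A subset $P\subseteq D(v)$ is a pipe dream for $u$ if the Demazure product of its labels in reading order is $u$. The pipe complex $\Delta_{v,w}$ is the simplicial complex on vertex set $D(v)$ whose faces are the $F\subseteq D(v)$ such that $D(v)\setminus F$ contains a pipe dream for $w_0w$. *)

theory Defs
  imports
    Complex_Main
    "HOL-Library.Poly_Mapping"
    "HOL-Combinatorics.Permutations"
    "Jordan_Normal_Form.Determinant"
    "Jordan_Normal_Form.DL_Submatrix"
begin

section \<open>Permutations\<close>

text \<open>Elements of \<open>S\<^sub>n\<close> are functions \<open>v :: nat \<Rightarrow> nat\<close> with \<open>v permutes {1..n}\<close>;
  the group operation is \<open>\<circ>\<close>.\<close>

definition perm_len :: "nat \<Rightarrow> (nat \<Rightarrow> nat) \<Rightarrow> nat" where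
  "perm_len n u = card {(a, b). a \<in> {1..n} \<and> b \<in> {1..n} \<and> a < b \<and> u b < u a}"

definition w0 :: "nat \<Rightarrow> nat \<Rightarrow> nat" where
  "w0 n k = (if k \<in> {1..n} then n + 1 - k else k)"

section \<open>Rothe diagram and essential set\<close>

text \<open>A position is a pair (row counted from the bottom, column counted from the left),
  both 1-based. The explicit ranges exclude the spurious positions with a coordinate 0.\<close>

definition rothe :: "nat \<Rightarrow> (nat \<Rightarrow> nat) \<Rightarrow> (nat \<times> nat) set" where
  "rothe n v = {(i, j). i \<in> {1..n} \<and> j \<in> {1..n} \<and>
                 i < n - v j + 1 \<and> j < inv_into UNIV v (n - i + 1)}"

definition ess_set :: "nat \<Rightarrow> (nat \<Rightarrow> nat) \<Rightarrow> (nat \<times> nat) set" where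
  "ess_set n w = {(i, j). (i, j) \<in> rothe n w \<and> (i + 1, j) \<notin> rothe n w \<and> (i, j + 1) \<notin> rothe n w}"

definition rank_fun :: "nat \<Rightarrow> (nat \<Rightarrow> nat) \<Rightarrow> nat \<Rightarrow> nat \<Rightarrow> nat" where
  "rank_fun n w i j = card {k \<in> {1..j}. w k \<ge> n - i + 1}"

section \<open>Polynomials and leading terms\<close>

type_synonym mon = "(nat \<times> nat) \<Rightarrow>\<^sub>0 nat"
type_synonym mpoly = "mon \<Rightarrow>\<^sub>0 complex"

definition zvar :: "nat \<times> nat \<Rightarrow> mpoly" where
  "zvar x = Poly_Mapping.single (Poly_Mapping.single x 1) 1"

text \<open>The type \<open>mpoly\<close> has one indeterminate for every pair of naturals; this is its
  subring of polynomials in the indeterminates indexed by the boxes of the Rothe diagram.\<close>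

definition zring :: "nat \<Rightarrow> (nat \<Rightarrow> nat) \<Rightarrow> mpoly set" where
  "zring n v = {p. \<forall>m \<in> Poly_Mapping.keys p. Poly_Mapping.keys m \<subseteq> rothe n v}"

definition var_less :: "nat \<times> nat \<Rightarrow> nat \<times> nat \<Rightarrow> bool" where
  "var_less x y \<longleftrightarrow> snd x < snd y \<or> snd x = snd y \<and> fst x > fst y"

text \<open>Lexicographic order: the largest indeterminate whose exponents differ decides.\<close>

definition mon_less :: "mon \<Rightarrow> mon \<Rightarrow> bool" where
  "mon_less m m' \<longleftrightarrow> (\<exists>x. Poly_Mapping.lookup m x < Poly_Mapping.lookup m' x \<and>
     (\<forall>y. var_less x y \<longrightarrow> Poly_Mapping.lookup m y = Poly_Mapping.lookup m' y))"

text \<open>Meaningful for nonzero polynomials only. The leading term includes the coefficient.\<close>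

definition lead_mon :: "mpoly \<Rightarrow> mon" where
  "lead_mon p = (THE m. m \<in> Poly_Mapping.keys p \<and>
     (\<forall>m' \<in> Poly_Mapping.keys p. m' \<noteq> m \<longrightarrow> mon_less m' m))"

definition lead_term :: "mpoly \<Rightarrow> mpoly" where
  "lead_term p = Poly_Mapping.single (lead_mon p) (Poly_Mapping.lookup p (lead_mon p))"

section \<open>Essential minors\<close>

definition Z_entry :: "nat \<Rightarrow> (nat \<Rightarrow> nat) \<Rightarrow> nat \<Rightarrow> nat \<Rightarrow> mpoly" where
  "Z_entry n v i j =
     (if i = n - v j + 1 then 1
      else if (\<exists>a \<in> {1..n}. a < j \<and> i = n - v a + 1) \<or> i > n - v j + 1 then 0
      else zvar (i, j))"

text \<open>Library matrices are indexed from the top left corner starting with 0, so index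
  \<open>(r, c)\<close> is position \<open>(n - r, c + 1)\<close>.\<close>

definition Z_mat :: "nat \<Rightarrow> (nat \<Rightarrow> nat) \<Rightarrow> mpoly mat" where
  "Z_mat n v = mat n n (\<lambda>(r, c). Z_entry n v (n - r) (c + 1))"

definition Z_sub :: "nat \<Rightarrow> (nat \<Rightarrow> nat) \<Rightarrow> nat \<Rightarrow> nat \<Rightarrow> mpoly mat" where
  "Z_sub n v i j = submatrix (Z_mat n v) {n - i..<n} {..<j}"

definition minors :: "nat \<Rightarrow> 'a::comm_ring_1 mat \<Rightarrow> 'a set" where
  "minors k M = {det (submatrix M A B) | A B.
     A \<subseteq> {..<dim_row M} \<and> B \<subseteq> {..<dim_col M} \<and> card A = k \<and> card B = k}"

definition ess_minors :: "nat \<Rightarrow> (nat \<Rightarrow> nat) \<Rightarrow> (nat \<Rightarrow> nat) \<Rightarrow> mpoly set" where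
  "ess_minors n v w = (\<Union>(i, j) \<in> ess_set n w. minors (1 + rank_fun n w i j) (Z_sub n v i j))"

section \<open>Pipe dreams and the pipe complex\<close>

definition box_label :: "nat \<Rightarrow> (nat \<Rightarrow> nat) \<Rightarrow> nat \<times> nat \<Rightarrow> nat" where
  "box_label n v = (\<lambda>(i, j). i + card {a. a < j \<and> (i, a) \<in> rothe n v})"

text \<open>Labels in reading order. Rows are numbered from the bottom, so top to bottom means
  decreasing \<open>i\<close>.\<close>

definition reading_word :: "nat \<Rightarrow> (nat \<Rightarrow> nat) \<Rightarrow> (nat \<times> nat) set \<Rightarrow> nat list" where
  "reading_word n v P =
     map (box_label n v)
       (filter (\<lambda>x. x \<in> P) (List.product (rev [1..<n + 1]) [1..<n + 1]))"

definition demazure_step :: "nat \<Rightarrow> (nat \<Rightarrow> nat) \<Rightarrow> nat \<Rightarrow> nat \<Rightarrow> nat" where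
  "demazure_step n u k =
     (let u' = u \<circ> Transposition.transpose k (k + 1) in if perm_len n u' > perm_len n u then u' else u)"

definition demazure :: "nat \<Rightarrow> nat list \<Rightarrow> nat \<Rightarrow> nat" where
  "demazure n = foldl (demazure_step n) id"

definition pipe_dream :: "nat \<Rightarrow> (nat \<Rightarrow> nat) \<Rightarrow> (nat \<Rightarrow> nat) \<Rightarrow> (nat \<times> nat) set \<Rightarrow> bool" where
  "pipe_dream n v u P \<longleftrightarrow> P \<subseteq> rothe n v \<and> demazure n (reading_word n v P) = u"

text \<open>The set of faces (empty, without even the face \<open>{}\<close>, if there is no pipe dream).\<close>

definition pipe_complex :: "nat \<Rightarrow> (nat \<Rightarrow> nat) \<Rightarrow> (nat \<Rightarrow> nat) \<Rightarrow> (nat \<times> nat) set set" where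
  "pipe_complex n v w =
     {F. F \<subseteq> rothe n v \<and> (\<exists>P \<subseteq> rothe n v - F. pipe_dream n v (w0 n \<circ> w) P)}"

end

theory Submission
  imports Defs
begin

text \<open>Write \<open>x\<close> for the Demazure product of the boxes outside \<open>S\<close>. If no subword of these boxes
  has Demazure product \<open>w\<^sub>0 w\<close>, then \<open>w\<^sub>0 w\<close> is not below \<open>x\<close> in Bruhat order, so that at some
  \<open>(i, j)\<close>, which may be moved into the essential set of \<open>w\<close>, the rank
  \<open>#{k \<le> j. x k \<le> i}\<close> exceeds \<open>r\<^sup>w\<close>. A Demazure step with label \<open>k\<close> changes the
  ranks in column \<open>k\<close> only, by \<open>r k := max (r (k - 1)) (r (k + 1) - 1)\<close>. Run along the reading word
  row by row, this is the recursion for the longest chain of boxes of \<open>S\<close> and entries 1, with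
  distinct rows and columns, that is the leading term of the minor it spans. Hence the bottom left
  \<open>i \<times> j\<close> block contains such a chain with more than \<open>r\<^sup>w\<close> elements, and since the term order is
  multiplicative, any subset of the chain of size \<open>1 + r\<^sup>w\<close> is still a leading term.\<close>

section \<open>Rank functions and the Bruhat order\<close>

text \<open>For \<open>u = w0 n \<circ> w\<close> these are the ranks r^w, and a permutation is
  Bruhat-larger when all its ranks are smaller or equal. Applied to \<open>v\<close>, the function
  counts columns whose 1 lies in the upper rows.\<close>

definition rk :: "(nat \<Rightarrow> nat) \<Rightarrow> nat \<Rightarrow> nat \<Rightarrow> nat" where
  "rk u i j = card {k \<in> {1..j}. u k \<le> i}"

lemma rk_0 [simp]: "rk u i 0 = 0"
  by (simp add: rk_def)

lemma rk_Suc: "rk u i (Suc j) = rk u i j + (if u (Suc j) \<le> i then 1 else 0)"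
proof -
  have "{k \<in> {1..Suc j}. u k \<le> i} =
    (if u (Suc j) \<le> i then insert (Suc j) {k \<in> {1..j}. u k \<le> i} else {k \<in> {1..j}. u k \<le> i})"
    by (auto simp: le_Suc_eq)
  then show ?thesis
    by (simp add: rk_def)
qed

lemma rk_cong: "(\<And>k. 1 \<le> k \<Longrightarrow> k \<le> j \<Longrightarrow> u k = u' k) \<Longrightarrow> rk u i j = rk u' i j"
  unfolding rk_def by (rule arg_cong[of _ _ card]) auto

lemma rk_le_col: "rk u i j \<le> j"
  by (induction j) (auto simp: rk_Suc intro: le_SucI)

lemma rk_mono_col: "a \<le> b \<Longrightarrow> rk u i a \<le> rk u i b"
  unfolding rk_def by (intro card_mono) auto

lemma rk_le_row:
  assumes "u permutes {1..n}"
  shows "rk u i j \<le> i"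
proof -
  have "inj_on u {k \<in> {1..j}. u k \<le> i}"
    using permutes_inj[OF assms] by (blast intro: inj_on_subset)
  moreover have "u k \<in> {1..i}" if "k \<ge> 1" "u k \<le> i" for k
    using that permutes_in_image[OF assms, of k] permutes_not_in[OF assms, of k]
    by (cases "k \<in> {1..n}") auto
  then have "u ` {k \<in> {1..j}. u k \<le> i} \<subseteq> {1..i}"
    by (intro image_subsetI) (simp only: mem_Collect_eq atLeastAtMost_iff)
  ultimately have "card {k \<in> {1..j}. u k \<le> i} \<le> card {1..i}"
    by (rule card_inj_on_le) simp
  then show ?thesis
    by (simp add: rk_def)
qed

lemma rk_Suc_row:
  assumes "u permutes {1..n}" "Suc i \<le> n"
  shows "rk u (Suc i) j = rk u i j + (if inv_into UNIV u (Suc i) \<le> j then 1 else 0)"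
proof -
  let ?k = "inv_into UNIV u (Suc i)"
  have k: "u ?k = Suc i" "?k \<ge> 1"
    using permutes_inverses(1)[OF assms(1)] permutes_in_image[OF permutes_inv[OF assms(1)], of "Suc i"] assms(2)
    by auto
  have eq: "u k = Suc i \<longleftrightarrow> k = ?k" for k
    by (metis assms(1) permutes_inv_eq)
  have "{k \<in> {1..j}. u k \<le> Suc i} =
    (if ?k \<le> j then insert ?k {k \<in> {1..j}. u k \<le> i} else {k \<in> {1..j}. u k \<le> i})"
    using k by (auto simp: le_Suc_eq eq)
  then show ?thesis
    using k by (simp add: rk_def)
qed

section \<open>Adjacent transpositions, length and Demazure steps\<close>

lemma transpose_adjacent_less:
  fixes a b k :: nat
  assumes "a < b" "(a, b) \<noteq> (k, k + 1)"
  shows "Transposition.transpose k (k + 1) a < Transposition.transpose k (k + 1) b"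
  using assms by (auto simp: transpose_def)

lemma permutes_comp_adjacent:
  fixes k n :: nat
  assumes "u permutes {1..n}" "k \<ge> 1" "k < n"
  shows "u \<circ> Transposition.transpose k (k + 1) permutes {1..n}"
  using assms by (intro permutes_compose permutes_swap_id) auto

text \<open>Applying s_k to both members of a pair injects the inversions of \<open>u\<close> into
  those of the product; the pair (k, k + 1) becomes an inversion and is not hit.\<close>

lemma perm_len_comp_adjacent:
  assumes "k \<ge> 1" "k < n" "u k < u (k + 1)"
  shows "perm_len n u < perm_len n (u \<circ> Transposition.transpose k (k + 1))"
proof -
  let ?t = "Transposition.transpose k (k + 1)"
  let ?I = "\<lambda>u. {(a, b). a \<in> {1..n} \<and> b \<in> {1..n} \<and> a < b \<and> u b < (u a :: nat)}"
  have fin: "finite (?I u)" for u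
    by (rule finite_subset[of _ "{1..n} \<times> {1..n}"]) auto
  have rng: "?t a \<in> {1..n}" if "a \<in> {1..n}" for a
    using that assms by (auto simp: transpose_def)
  have sub: "map_prod ?t ?t ` ?I u \<subseteq> ?I (u \<circ> ?t) - {(k, k + 1)}"
  proof
    fix p assume "p \<in> map_prod ?t ?t ` ?I u"
    then obtain a b where p: "p = (?t a, ?t b)" and
      ab: "a \<in> {1..n}" "b \<in> {1..n}" "a < b" "u b < u a"
      by auto
    have "(a, b) \<noteq> (k, k + 1)"
      using ab assms by auto
    then have "?t a < ?t b"
      using ab by (intro transpose_adjacent_less)
    moreover have "(?t a, ?t b) \<noteq> (k, k + 1)"
      using ab by (auto simp: transpose_def split: if_splits)
    ultimately show "p \<in> ?I (u \<circ> ?t) - {(k, k + 1)}"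
      using p ab rng[of a] rng[of b] by auto
  qed
  have inj: "inj_on (map_prod ?t ?t) (?I u)"
    by (rule inj_on_subset[OF map_prod_inj_on[OF bij_is_inj bij_is_inj]]) auto
  have mem: "(k, k + 1) \<in> ?I (u \<circ> ?t)"
    using assms by auto
  have "card (?I u) = card (map_prod ?t ?t ` ?I u)"
    using inj by (simp add: card_image)
  also have "\<dots> \<le> card (?I (u \<circ> ?t) - {(k, k + 1)})"
    using sub fin by (intro card_mono) auto
  also have "\<dots> < card (?I (u \<circ> ?t))"
    using mem fin by (intro psubset_card_mono) auto
  finally show ?thesis
    by (simp add: perm_len_def)
qed

lemma demazure_step_eq:
  assumes "u permutes {1..n}" "k \<ge> 1" "k < n"
  shows "demazure_step n u k =
    (if u k < u (k + 1) then u \<circ> Transposition.transpose k (k + 1) else u)"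
proof -
  let ?t = "Transposition.transpose k (k + 1)"
  have "u k \<noteq> u (k + 1)"
    using inj_eq[OF permutes_inj[OF assms(1)], of k "k + 1"] by simp
  \<comment> \<open>At a descent the previous lemma is applied to \<open>u \<circ> ?t\<close>, whose
    product with \<open>?t\<close> is \<open>u\<close>.\<close>
  moreover have "perm_len n (u \<circ> ?t) < perm_len n u" if "u (k + 1) < u k"
  proof -
    have "(u \<circ> ?t) k < (u \<circ> ?t) (k + 1)"
      using that by simp
    from perm_len_comp_adjacent[OF assms(2,3) this] show ?thesis
      by (simp only: comp_assoc transpose_comp_involutory comp_id)
  qed
  moreover have "perm_len n u < perm_len n (u \<circ> ?t)" if "u k < u (k + 1)"
    using assms that by (intro perm_len_comp_adjacent)
  ultimately show ?thesis
    unfolding demazure_step_def Let_def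
    by (metis linorder_neqE_nat order_less_asym)
qed

lemma demazure_step_permutes:
  assumes "u permutes {1..n}" "k \<ge> 1" "k < n"
  shows "demazure_step n u k permutes {1..n}"
  using assms permutes_comp_adjacent[OF assms] by (simp add: demazure_step_eq)

text \<open>For \<open>j \<noteq> k\<close> the transposition maps {1..j} to itself, so it only
  reorders the values that are counted.\<close>

lemma rk_comp_adjacent:
  assumes "k \<ge> (1::nat)" "j \<noteq> k"
  shows "rk (u \<circ> Transposition.transpose k (k + 1)) i j = rk u i j"
proof (cases "j < k")
  case True
  then show ?thesis
    by (intro rk_cong) auto
next
  case False
  let ?t = "Transposition.transpose k (k + 1)"
  have "{a \<in> {1..j}. u a \<le> i} = ?t ` {a \<in> {1..j}. (u \<circ> ?t) a \<le> i}"
  proof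
    show "{a \<in> {1..j}. u a \<le> i} \<subseteq> ?t ` {a \<in> {1..j}. (u \<circ> ?t) a \<le> i}"
    proof
      fix a assume "a \<in> {a \<in> {1..j}. u a \<le> i}"
      then have "?t a \<in> {a \<in> {1..j}. (u \<circ> ?t) a \<le> i}"
        using False assms by (auto simp: transpose_def)
      then have "?t (?t a) \<in> ?t ` {a \<in> {1..j}. (u \<circ> ?t) a \<le> i}"
        by (rule imageI)
      then show "a \<in> ?t ` {a \<in> {1..j}. (u \<circ> ?t) a \<le> i}"
        by (simp only: transpose_involutory)
    qed
  qed (use False assms in \<open>auto simp: transpose_def\<close>)
  moreover have "inj_on ?t X" for X
    using bij_is_inj[OF bij_transpose] by (rule inj_on_subset) simp
  ultimately show ?thesis
    by (simp add: rk_def card_image)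
qed

lemma rk_demazure_step_other:
  assumes "u permutes {1..n}" "k \<ge> 1" "k < n" "j \<noteq> k"
  shows "rk (demazure_step n u k) i j = rk u i j"
  using assms rk_comp_adjacent by (simp add: demazure_step_eq)

text \<open>The step leaves columns k - 1 and k + 1 alone and ends with a descent at k. A value at
  most \<open>i\<close> at position k then forces one at k + 1, so the rank in column k is the least
  that its neighbours permit.\<close>

lemma rk_demazure_step:
  assumes "u permutes {1..n}" "k \<ge> 1" "k < n"
  shows "rk (demazure_step n u k) i k = max (rk u i (k - 1)) (rk u i (k + 1) - 1)"
proof -
  obtain m where k: "k = Suc m"
    using assms(2) by (cases k) auto
  let ?x = "demazure_step n u k"
  have desc: "?x (k + 1) \<le> ?x k"
    using assms by (simp add: demazure_step_eq)
  have "rk ?x i m = rk u i m" "rk ?x i (Suc k) = rk u i (Suc k)"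
    using assms k by (simp_all add: rk_demazure_step_other)
  then show ?thesis
    using desc by (auto simp: k rk_Suc split: if_splits)
qed

text \<open>The lifting property: \<open>u'\<close> below is whichever of \<open>u\<close> and \<open>u s\<^sub>k\<close> is shorter, and
  the rank of an ascending permutation in column \<open>k\<close> is the largest one that the columns
  \<open>k - 1\<close> and \<open>k + 1\<close> permit.\<close>

lemma bruhat_lifting:
  assumes "u permutes {1..n}" "x permutes {1..n}" "k \<ge> 1" "k < n"
    and le: "\<And>i j. i \<le> n \<Longrightarrow> j \<le> n \<Longrightarrow> rk (demazure_step n x k) i j \<le> rk u i j"
  obtains u' where "u' permutes {1..n}" "u = u' \<or> u = demazure_step n u' k"
    "\<And>i j. i \<le> n \<Longrightarrow> j \<le> n \<Longrightarrow> rk x i j \<le> rk u' i j"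
proof -
  let ?t = "Transposition.transpose k (k + 1)"
  define u' where "u' = (if u k < u (k + 1) then u else u \<circ> ?t)"
  have perm: "u' permutes {1..n}"
    using assms(1) permutes_comp_adjacent[OF assms(1,3,4)] by (simp add: u'_def)
  have "u k \<noteq> u (k + 1)"
    using inj_eq[OF permutes_inj[OF assms(1)], of k "k + 1"] by simp
  then have asc: "u' k < u' (k + 1)"
    by (auto simp: u'_def)
  have u: "u = u' \<or> u = demazure_step n u' k"
    using demazure_step_eq[OF perm assms(3,4)] asc by (auto simp: u'_def comp_assoc)
  have other: "rk x i j \<le> rk u' i j" if "j \<noteq> k" "i \<le> n" "j \<le> n" for i j
    using le[of i j] that assms(1-4)
    by (auto simp: u'_def rk_comp_adjacent[simplified] rk_demazure_step_other)
  have "rk x i j \<le> rk u' i j" if "i \<le> n" "j \<le> n" for i j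
  proof (cases "j = k")
    case True
    obtain m where k: "k = Suc m"
      using assms(3) by (cases k) auto
    show ?thesis
      using other[of m i] other[of "Suc k" i] asc True assms(4) that
      by (auto simp: k rk_Suc split: if_splits)
  qed (use other that in blast)
  then show ?thesis
    using that perm u by blast
qed

section \<open>Demazure products of words and the subword property\<close>

lemma foldl_demazure_permutes:
  assumes "u permutes {1..n}" "\<forall>k \<in> set ks. 1 \<le> k \<and> k < n"
  shows "foldl (demazure_step n) u ks permutes {1..n}"
  using assms by (induction ks arbitrary: u) (auto simp: demazure_step_permutes simp del: One_nat_def)

lemma rk_foldl_demazure_other:
  assumes "u permutes {1..n}" "\<forall>k \<in> set ks. 1 \<le> k \<and> k < n" "j \<notin> set ks"
  shows "rk (foldl (demazure_step n) u ks) i j = rk u i j"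
  using assms
  by (induction ks arbitrary: u)
    (auto simp: demazure_step_permutes rk_demazure_step_other simp del: One_nat_def)

text \<open>All of 1, ..., k have values at most k, so \<open>u k \<le> k\<close> for every k, which
  only the identity satisfies.\<close>

lemma permutes_le_imp_id:
  assumes "u permutes {1..n}" "\<And>i. i \<le> n \<Longrightarrow> i \<le> rk u i i"
  shows "u = id"
proof (rule permutes_natset_le[OF assms(1)])
  show "\<forall>k\<in>{1..n}. u k \<le> k"
  proof
    fix k assume k: "k \<in> {1..n}"
    then have "{a \<in> {1..k}. u a \<le> k} = {1..k}"
      using assms(2)[of k] rk_le_col[of u k k] unfolding rk_def
      by (intro card_subset_eq) (simp_all add: subset_iff)
    then have "k \<in> {a \<in> {1..k}. u a \<le> k}"
      using k by (simp only: atLeastAtMost_iff order_refl simp_thms)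
    then show "u k \<le> k"
      by simp
  qed
qed

lemma demazure_Nil [simp]: "demazure n [] = id"
  by (simp add: demazure_def)

lemma demazure_append [simp]:
  "demazure n (ks @ ls) = foldl (demazure_step n) (demazure n ks) ls"
  by (simp add: demazure_def)

lemma demazure_permutes:
  assumes "\<forall>k \<in> set ks. 1 \<le> k \<and> k < n"
  shows "demazure n ks permutes {1..n}"
  unfolding demazure_def using permutes_id assms by (rule foldl_demazure_permutes)

text \<open>Induction from the last letter: \<open>bruhat_lifting\<close> supplies a
  \<open>u'\<close> below the shorter product; the letter is dropped if \<open>u = u'\<close> and
  added if \<open>u\<close> arises from \<open>u'\<close> by its step. The letters are indexed by
  distinct \<open>xs\<close>, so that a subword is a set of boxes.\<close>

lemma subword_property:
  assumes "u permutes {1..n}" "distinct xs" "\<forall>x \<in> set xs. 1 \<le> f x \<and> f x < n"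
    and "\<And>i j. i \<le> n \<Longrightarrow> j \<le> n \<Longrightarrow> rk (demazure n (map f xs)) i j \<le> rk u i j"
  shows "\<exists>P \<subseteq> set xs. demazure n (map f (filter (\<lambda>x. x \<in> P) xs)) = u"
  using assms
proof (induction xs arbitrary: u rule: rev_induct)
  case Nil
  have "i \<le> rk u i i" if "i \<le> n" for i
  proof -
    have "{k \<in> {1..i}. id k \<le> i} = {1..i}"
      by auto
    then have "rk id i i = i"
      by (simp add: rk_def)
    then show ?thesis
      using Nil.prems(4)[OF that that] by (simp add: id_def[symmetric])
  qed
  then have "u = id"
    using Nil.prems by (intro permutes_le_imp_id)
  then show ?case
    by simp
next
  case (snoc x xs)
  let ?d = "\<lambda>ys. demazure n (map f ys)"
  have "?d xs permutes {1..n}"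
    using snoc.prems(3) by (intro demazure_permutes) simp
  moreover have "1 \<le> f x" "f x < n" "x \<notin> set xs"
    using snoc.prems by auto
  moreover have "rk (demazure_step n (?d xs) (f x)) i j \<le> rk u i j" if "i \<le> n" "j \<le> n" for i j
    using snoc.prems(4)[OF that] by simp
  ultimately obtain u' where u': "u' permutes {1..n}" "u = u' \<or> u = demazure_step n u' (f x)"
    "\<And>i j. i \<le> n \<Longrightarrow> j \<le> n \<Longrightarrow> rk (?d xs) i j \<le> rk u' i j"
    using bruhat_lifting[OF snoc.prems(1), of "?d xs" "f x"] by blast
  obtain P where P: "P \<subseteq> set xs" "?d (filter (\<lambda>x. x \<in> P) xs) = u'"
    using snoc.IH[OF u'(1)] u'(3) snoc.prems by auto
  have "x \<notin> P"
    using P \<open>x \<notin> set xs\<close> by auto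
  have "filter (\<lambda>y. y \<in> insert x P) xs = filter (\<lambda>y. y \<in> P) xs"
    using \<open>x \<notin> set xs\<close> by (intro filter_cong) auto
  then show ?case
    using u'(2) P \<open>x \<notin> P\<close>
    by (elim disjE; intro exI[of _ P] exI[of _ "insert x P"]) auto
qed

section \<open>Reduction to the essential set\<close>

lemma w0_permutes: "w0 n permutes {1..n}"
proof (rule bij_imp_permutes)
  show "bij_betw (w0 n) {1..n} {1..n}"
    by (rule bij_betwI[where g = "w0 n"]) (auto simp: w0_def)
qed (auto simp: w0_def)

text \<open>\<open>w0 n \<circ> w\<close> sends a column to the row of its 1 counted from the
  bottom. Boxes are thus the positions below the 1 of their column and left of the 1 of their
  row.\<close>

lemma rothe_iff:
  assumes "w permutes {1..n}"
  shows "(i, j) \<in> rothe n w \<longleftrightarrow>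
    i \<in> {1..n} \<and> j \<in> {1..n} \<and> i < (w0 n \<circ> w) j \<and> j < inv_into UNIV (w0 n \<circ> w) i"
proof -
  have "inv_into UNIV (w0 n \<circ> w) i = inv_into UNIV w (n - i + 1)" if "i \<in> {1..n}"
  proof -
    have "(w0 n \<circ> w) (inv_into UNIV w (n - i + 1)) = i"
      using that permutes_inverses(1)[OF assms, of "n - i + 1"] by (auto simp: w0_def)
    then show ?thesis
      using permutes_inj[OF permutes_compose[OF assms w0_permutes]] by (metis inv_f_f)
  qed
  moreover have "(w0 n \<circ> w) j = n - w j + 1" if "j \<in> {1..n}"
  proof -
    have "w j \<in> {1..n}"
      using that permutes_in_image[OF assms] by blast
    then show ?thesis
      by (auto simp: w0_def)
  qed
  ultimately show ?thesis
    by (auto simp: rothe_def)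
qed

lemma rank_fun_eq_rk:
  assumes "w permutes {1..n}" "i \<le> n" "j \<le> n"
  shows "rank_fun n w i j = rk (w0 n \<circ> w) i j"
proof -
  have "w k \<ge> n - i + 1 \<longleftrightarrow> (w0 n \<circ> w) k \<le> i" if "k \<in> {1..j}" for k
  proof -
    have "w k \<in> {1..n}"
      using that assms permutes_in_image[OF assms(1), of k] by auto
    then show ?thesis
      using assms by (auto simp: w0_def)
  qed
  then show ?thesis
    unfolding rank_fun_def rk_def by (intro arg_cong[of _ _ card]) auto
qed



text \<open>A violation with least \<open>i + j\<close> lies in the diagram, since outside it one
  step left or down leads to another violation. A violation in the diagram with greatest sum is then
  in the essential set, since a step up or right within the diagram keeps the rank of
  \<open>u\<close> and does not lower that of \<open>x\<close>.\<close>

lemma rk_violation_in_ess_set: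
  assumes "w permutes {1..n}" "x permutes {1..n}" "i \<le> n" "j \<le> n" "rk (w0 n \<circ> w) i j < rk x i j"
  shows "\<exists>(i, j) \<in> ess_set n w. rank_fun n w i j < rk x i j"
proof -
  define u where "u = w0 n \<circ> w"
  have u: "u permutes {1..n}"
    unfolding u_def using assms(1) w0_permutes by (rule permutes_compose)
  define V where "V = {(i, j). i \<le> n \<and> j \<le> n \<and> rk u i j < rk x i j}"
  have "(i, j) \<in> V"
    using assms by (simp add: V_def u_def)
  then obtain p where p: "p \<in> V" "\<And>q. q \<in> V \<Longrightarrow> fst p + snd p \<le> fst q + snd q"
    using ex_has_least_nat[of "\<lambda>p. p \<in> V" _ "\<lambda>p. fst p + snd p"] by blast
  obtain i j where ij: "p = (i, j)"
    by (cases p)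
  have "i \<noteq> 0"
    using p(1) rk_le_row[OF assms(2), of 0 j] by (intro notI) (simp add: V_def ij)
  moreover have "j \<noteq> 0"
    using p(1) by (cases j) (auto simp: V_def ij)
  ultimately obtain i' j' where Suc: "i = Suc i'" "j = Suc j'"
    by (metis not0_implies_Suc)
  \<comment> \<open>If \<open>u j \<le> i\<close>, column \<open>j\<close> adds 1 to the rank of
    \<open>u\<close> and at most 1 to that of \<open>x\<close>.\<close>
  have "i < u j"
  proof (rule ccontr)
    assume "\<not> i < u j"
    then have "(i, j') \<in> V"
      using p(1) by (auto simp: V_def ij Suc rk_Suc split: if_splits)
    then show False
      using p(2) by (force simp: ij Suc)
  qed
  moreover have "j < inv_into UNIV u i"
  proof (rule ccontr)
    assume "\<not> j < inv_into UNIV u i"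
    then have "(i', j) \<in> V"
      using p(1) by (auto simp: V_def ij Suc rk_Suc_row[OF u] rk_Suc_row[OF assms(2)] split: if_splits)
    then show False
      using p(2) by (force simp: ij Suc)
  qed
  ultimately have "p \<in> V \<inter> rothe n w"
    using p(1) \<open>i \<noteq> 0\<close> \<open>j \<noteq> 0\<close> rothe_iff[OF assms(1)] by (auto simp: V_def ij u_def)
  moreover have "\<forall>q. q \<in> V \<inter> rothe n w \<longrightarrow> fst q + snd q < Suc (n + n)"
    by (auto simp: V_def)
  ultimately obtain q where q: "q \<in> V \<inter> rothe n w"
    "\<And>q'. q' \<in> V \<inter> rothe n w \<Longrightarrow> fst q' + snd q' \<le> fst q + snd q"
    using Lattices_Big.ex_has_greatest_nat[of "\<lambda>q. q \<in> V \<inter> rothe n w" p "\<lambda>q. fst q + snd q"]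
    by blast
  obtain a b where ab: "q = (a, b)"
    by (cases q)
  have "(a + 1, b) \<notin> rothe n w"
  proof
    assume r: "(a + 1, b) \<in> rothe n w"
    then have "Suc a \<le> n" "b < inv_into UNIV u (Suc a)"
      by (auto simp: rothe_iff[OF assms(1)] u_def)
    then have "(a + 1, b) \<in> V"
      using q(1) by (auto simp: V_def ab rk_Suc_row[OF u] rk_Suc_row[OF assms(2)])
    then show False
      using q(2)[of "(a + 1, b)"] r by (simp add: ab)
  qed
  moreover have "(a, b + 1) \<notin> rothe n w"
  proof
    assume r: "(a, b + 1) \<in> rothe n w"
    then have "Suc b \<le> n" "a < u (Suc b)"
      by (auto simp: rothe_iff[OF assms(1)] u_def)
    then have "(a, b + 1) \<in> V"
      using q(1) by (auto simp: V_def ab rk_Suc)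
    then show False
      using q(2)[of "(a, b + 1)"] r by (simp add: ab)
  qed
  ultimately have "q \<in> ess_set n w"
    using q(1) by (simp add: ess_set_def ab)
  moreover have "rank_fun n w a b < rk x a b"
    using q(1) rank_fun_eq_rk[OF assms(1)] by (auto simp: V_def ab u_def)
  ultimately show ?thesis
    by (auto simp: ab)
qed

section \<open>Leading matchings\<close>

definition ones :: "nat \<Rightarrow> (nat \<Rightarrow> nat) \<Rightarrow> (nat \<times> nat) set" where
  "ones n v = {(n - v j + 1, j) | j. j \<in> {1..n}}"

definition matching :: "nat \<Rightarrow> (nat \<Rightarrow> nat) \<Rightarrow> (nat \<times> nat) set \<Rightarrow> bool" where
  "matching n v T \<longleftrightarrow> inj_on fst T \<and> inj_on snd T \<and> T \<subseteq> rothe n v \<union> ones n v"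

text \<open>A matching stands for a nonvanishing term of the minor in its rows and columns. Such a
  term is determined by its monomial, which is the product over the boxes of \<open>rothe\<close>.\<close>

definition leading_matching :: "nat \<Rightarrow> (nat \<Rightarrow> nat) \<Rightarrow> (nat \<times> nat) set \<Rightarrow> bool" where
  "leading_matching n v M \<longleftrightarrow> matching n v M \<and>
     (\<forall>T. matching n v T \<longrightarrow> fst ` T = fst ` M \<longrightarrow> snd ` T = snd ` M \<longrightarrow> T \<noteq> M \<longrightarrow>
        (\<exists>x \<in> M \<inter> rothe n v - T. \<forall>y \<in> rothe n v. var_less x y \<longrightarrow> (y \<in> M \<longleftrightarrow> y \<in> T)))"

lemma ones_inter_rothe: "ones n v \<inter> rothe n v = {}"
  by (auto simp: ones_def rothe_def)

lemma matching_subset: "matching n v T \<Longrightarrow> T' \<subseteq> T \<Longrightarrow> matching n v T'"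
  unfolding matching_def by (blast intro: inj_on_subset)

lemma leading_matching_empty: "leading_matching n v {}"
  by (auto simp: leading_matching_def matching_def)

text \<open>A competitor \<open>T\<close> containing \<open>x\<close> reduces to the competitor
  \<open>T - {x}\<close> of \<open>M\<close>. One that avoids \<open>x\<close> must lose at
  \<open>x\<close> itself, which \<open>max\<close> ensures: \<open>x\<close> is a box, and neither
  side has a larger variable.\<close>

lemma leading_matching_insert:
  assumes M: "leading_matching n v M" and x: "x \<in> rothe n v \<union> ones n v"
    and new: "fst x \<notin> fst ` M" "snd x \<notin> snd ` M"
    and max: "\<And>T. matching n v T \<Longrightarrow> fst ` T = insert (fst x) (fst ` M) \<Longrightarrow>
      snd ` T = insert (snd x) (snd ` M) \<Longrightarrow> x \<notin> T \<Longrightarrow>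
      x \<in> rothe n v \<and> (\<forall>y \<in> rothe n v. var_less x y \<longrightarrow> y \<notin> M \<and> y \<notin> T)"
  shows "leading_matching n v (insert x M)"
  unfolding leading_matching_def
proof (intro conjI allI impI)
  show "matching n v (insert x M)"
    using M x new by (auto simp: leading_matching_def matching_def)
  fix T assume T: "matching n v T" "fst ` T = fst ` insert x M" "snd ` T = snd ` insert x M"
    "T \<noteq> insert x M"
  have irrefl: "\<not> var_less x x"
    by (simp add: var_less_def)
  show "\<exists>y \<in> insert x M \<inter> rothe n v - T. \<forall>z \<in> rothe n v. var_less y z \<longrightarrow> (z \<in> insert x M \<longleftrightarrow> z \<in> T)"
  proof (cases "x \<in> T")
    case True
    have "inj_on fst T" "inj_on snd T"
      using T by (auto simp: matching_def)
    then have "fst ` (T - {x}) = fst ` M" "snd ` (T - {x}) = snd ` M"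
      using T True new by (auto simp: inj_on_image_set_diff)
    moreover have "matching n v (T - {x})"
      using T(1) by (rule matching_subset) auto
    moreover have "T - {x} \<noteq> M"
      using T True by auto
    ultimately obtain y where "y \<in> M \<inter> rothe n v - (T - {x})"
      "\<forall>z \<in> rothe n v. var_less y z \<longrightarrow> (z \<in> M \<longleftrightarrow> z \<in> T - {x})"
      using M unfolding leading_matching_def by metis
    moreover have "x \<notin> M"
      using new by auto
    ultimately show ?thesis
      using True by (intro bexI[of _ y]) auto
  next
    case False
    have "x \<in> rothe n v" "\<forall>y \<in> rothe n v. var_less x y \<longrightarrow> y \<notin> M \<and> y \<notin> T"
      using max[OF T(1) _ _ False] T(2,3) by simp_all
    then show ?thesis
      using False irrefl by (intro bexI[of _ x]) auto
  qed
qed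

text \<open>The term order is multiplicative, hence a factor of a leading term is leading.\<close>

lemma leading_matching_subset:
  assumes M: "leading_matching n v M" and sub: "M' \<subseteq> M"
  shows "leading_matching n v M'"
  unfolding leading_matching_def
proof (intro conjI allI impI)
  have mM: "matching n v M"
    using M by (simp add: leading_matching_def)
  then show "matching n v M'"
    using sub by (rule matching_subset)
  fix T assume T: "matching n v T" "fst ` T = fst ` M'" "snd ` T = snd ` M'" "T \<noteq> M'"
  let ?R = "M - M'"
  have inj: "inj_on fst M" "inj_on snd M"
    using mM by (auto simp: matching_def)
  have disj: "fst ` T \<inter> fst ` ?R = {}" "snd ` T \<inter> snd ` ?R = {}"
    using T sub inj by (auto simp: inj_on_def subset_iff)
  \<comment> \<open>Completed by the removed entries, \<open>T\<close> competes with
    \<open>M\<close>, and the variable that decides this comparison also decides the one with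
    \<open>M'\<close>.\<close>
  have "matching n v (T \<union> ?R)"
    using T(1) mM disj unfolding matching_def
    by (auto simp: inj_on_Un intro: inj_on_subset)
  moreover have "fst ` (T \<union> ?R) = fst ` M" "snd ` (T \<union> ?R) = snd ` M"
    using T sub by (auto simp: image_Un image_iff)
  moreover have TR: "T \<inter> ?R = {}"
    using disj by auto
  then have "T \<union> ?R \<noteq> M"
    using T(4) sub by auto
  ultimately obtain x where "x \<in> M \<inter> rothe n v - (T \<union> ?R)"
    "\<forall>y \<in> rothe n v. var_less x y \<longrightarrow> (y \<in> M \<longleftrightarrow> y \<in> T \<union> ?R)"
    using M unfolding leading_matching_def by metis
  then show "\<exists>x \<in> M' \<inter> rothe n v - T. \<forall>y \<in> rothe n v. var_less x y \<longrightarrow> (y \<in> M' \<longleftrightarrow> y \<in> T)"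
    using TR sub by (intro bexI[of _ x]) auto
qed

text \<open>Among the rows and columns in play, column \<open>j\<close> is the last and row
  \<open>r\<close> the lowest, which makes this box the largest variable available to either
  side.\<close>

lemma leading_matching_insert_box:
  assumes M: "leading_matching n v M" and x: "(r, j) \<in> rothe n v"
    and M_sub: "M \<subseteq> {r<..} \<times> {..<j}"
  shows "leading_matching n v (insert (r, j) M)"
proof (rule leading_matching_insert[OF M])
  show "(r, j) \<in> rothe n v \<union> ones n v" "fst (r, j) \<notin> fst ` M" "snd (r, j) \<notin> snd ` M"
    using x M_sub by auto
  fix T assume T: "fst ` T = insert (fst (r, j)) (fst ` M)" "snd ` T = insert (snd (r, j)) (snd ` M)"
  have "y \<notin> T" if "var_less (r, j) y" for y
  proof
    assume "y \<in> T"
    then have "fst y \<in> insert r (fst ` M)" "snd y \<in> insert j (snd ` M)"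
      using T by (auto simp flip: T)
    then show False
      using that M_sub by (fastforce simp: var_less_def)
  qed
  moreover have "y \<notin> M" if "var_less (r, j) y" for y
    using that M_sub by (fastforce simp: var_less_def)
  ultimately show "(r, j) \<in> rothe n v \<and> (\<forall>y \<in> rothe n v. var_less (r, j) y \<longrightarrow> y \<notin> M \<and> y \<notin> T)"
    using x by blast
qed

lemma above_one_notin:
  assumes "r > n - v j + 1"
  shows "(r, j) \<notin> rothe n v \<union> ones n v"
  using assms by (auto simp: rothe_def ones_def)

text \<open>Entries of Z above a 1 vanish, and the rows of \<open>M\<close> all lie above
  \<open>r\<close>. So column \<open>j\<close> is still free in \<open>M\<close>, and no competitor
  can cover it other than by this 1.\<close>

lemma leading_matching_insert_one:
  assumes M: "leading_matching n v M" and x: "(r, j) \<in> ones n v"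
    and M_sub: "M \<subseteq> {r<..} \<times> UNIV"
  shows "leading_matching n v (insert (r, j) M)"
proof (rule leading_matching_insert[OF M])
  have above: "(r', j) \<notin> rothe n v \<union> ones n v" if "r' > r" for r'
    using that x by (intro above_one_notin) (auto simp: ones_def)
  show "(r, j) \<in> rothe n v \<union> ones n v" "fst (r, j) \<notin> fst ` M"
    using x M_sub by auto
  show "snd (r, j) \<notin> snd ` M"
  proof
    assume "snd (r, j) \<in> snd ` M"
    then obtain r' where r': "(r', j) \<in> M"
      by auto
    then have "(r', j) \<in> rothe n v \<union> ones n v"
      using M unfolding leading_matching_def matching_def by blast
    moreover have "r' > r"
      using M_sub r' by auto
    ultimately show False
      using above by blast
  qed
  fix T assume T: "matching n v T" "fst ` T = insert (fst (r, j)) (fst ` M)"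
    "snd ` T = insert (snd (r, j)) (snd ` M)" "(r, j) \<notin> T"
  have "j \<in> snd ` T"
    using T by auto
  then obtain r' where r': "(r', j) \<in> T"
    by auto
  then have "r' \<in> fst ` T"
    by force
  then have "r' \<in> insert r (fst ` M)"
    by (simp add: T(2))
  then have "r' = r \<or> r' > r"
    using M_sub by auto
  then have False
    using r' T(1,4) above[of r'] unfolding matching_def by blast
  then show "(r, j) \<in> rothe n v \<and> (\<forall>y \<in> rothe n v. var_less (r, j) y \<longrightarrow> y \<notin> M \<and> y \<notin> T)" ..
qed

section \<open>Matchings from Demazure products\<close>

text \<open>The boxes of row \<open>r\<close> left of column \<open>j\<close> occupy the columns
  whose 1 lies above row \<open>r\<close>. The rank also counts column \<open>j\<close>, the label
  does not; hence the 1 on the left.\<close>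

lemma box_label_eq:
  assumes v: "v permutes {1..n}" and x: "(r, j) \<in> rothe n v"
  shows "box_label n v (r, j) + 1 = r + rk v (n - r) j"
proof -
  obtain j' where j: "j = Suc j'"
    using x by (cases j) (auto simp: rothe_def)
  have "{a. a < j \<and> (r, a) \<in> rothe n v} = {a \<in> {1..j'}. v a \<le> n - r}"
    using x by (auto simp: rothe_def j)
  moreover have "v j \<le> n - r"
    using x by (auto simp: rothe_def)
  ultimately show ?thesis
    by (simp add: box_label_def j rk_Suc) (simp add: rk_def)
qed

lemma box_label_bounds:
  assumes "v permutes {1..n}" "x \<in> rothe n v"
  shows "1 \<le> box_label n v x" "box_label n v x < n"
proof -
  obtain r j where x: "x = (r, j)"
    by (cases x)
  have "1 \<le> r" "r \<le> n"
    using assms by (auto simp: rothe_def x)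
  then show "1 \<le> box_label n v x" "box_label n v x < n"
    using box_label_eq[OF assms(1), of r j] assms(2) rk_le_row[OF assms(1), of "n - r" j]
    by (auto simp: x box_label_def)
qed

lemma box_label_less:
  assumes "(r, a) \<in> rothe n v" "a < b"
  shows "box_label n v (r, a) < box_label n v (r, b)"
proof -
  have "{c. c < a \<and> (r, c) \<in> rothe n v} \<subset> {c. c < b \<and> (r, c) \<in> rothe n v}"
    using assms by force
  then have "card {c. c < a \<and> (r, c) \<in> rothe n v} < card {c. c < b \<and> (r, c) \<in> rothe n v}"
    by (rule psubset_card_mono[rotated]) simp
  then show ?thesis
    by (simp add: box_label_def)
qed

text \<open>Since the word increases, when k is read column k - 1 already has its final rank and
  column k + 1 still has the one under \<open>u\<close>. Later letters exceed k and leave column k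
  alone.\<close>

lemma rk_foldl_demazure_sorted:
  assumes u: "u permutes {1..n}" and ks: "\<forall>k \<in> set ks. 1 \<le> k \<and> k < n" "sorted_wrt (<) ks"
    and k: "k \<in> set ks"
  shows "rk (foldl (demazure_step n) u ks) i k =
    max (rk (foldl (demazure_step n) u ks) i (k - 1)) (rk u i (k + 1) - 1)"
proof -
  obtain as bs where split: "ks = as @ k # bs"
    using split_list[OF k] by blast
  define x where "x = foldl (demazure_step n) u as"
  define y where "y = demazure_step n x k"
  have as: "\<forall>k \<in> set as. 1 \<le> k \<and> k < n" and bs: "\<forall>k \<in> set bs. 1 \<le> k \<and> k < n"
    and kn: "1 \<le> k" "k < n"
    using ks(1) by (auto simp: split)
  have x: "x permutes {1..n}"
    unfolding x_def using u as by (rule foldl_demazure_permutes)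
  have y: "y permutes {1..n}"
    unfolding y_def using x kn by (rule demazure_step_permutes)
  have "k \<notin> set bs" "k - 1 \<notin> set bs" "k + 1 \<notin> set as"
    using ks(2) by (auto simp: split sorted_wrt_append)
  then have "rk (foldl (demazure_step n) y bs) i k = rk y i k"
    "rk (foldl (demazure_step n) y bs) i (k - 1) = rk y i (k - 1)"
    "rk x i (k + 1) = rk u i (k + 1)"
    using rk_foldl_demazure_other[OF y bs] rk_foldl_demazure_other[OF u as] by (simp_all add: x_def)
  moreover have "rk y i (k - 1) = rk x i (k - 1)"
    unfolding y_def using x kn by (intro rk_demazure_step_other) auto
  moreover have "rk y i k = max (rk x i (k - 1)) (rk x i (k + 1) - 1)"
    unfolding y_def using x kn by (rule rk_demazure_step)
  moreover have "foldl (demazure_step n) u ks = foldl (demazure_step n) y bs"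
    by (simp add: split x_def y_def)
  ultimately show ?thesis
    by simp
qed

section \<open>The reading word, row by row\<close>

lemma product_append: "List.product (xs @ ys) zs = List.product xs zs @ List.product ys zs"
  by (induction xs) auto

text \<open>With \<open>r = 1\<close> this is the reading word, and decreasing \<open>r\<close>
  appends one more \<open>row_word\<close>.\<close>

definition upper_word :: "nat \<Rightarrow> (nat \<Rightarrow> nat) \<Rightarrow> (nat \<times> nat) set \<Rightarrow> nat \<Rightarrow> nat list" where
  "upper_word n v P r =
     map (box_label n v) (filter (\<lambda>x. x \<in> P) (List.product (rev [r..<n + 1]) [1..<n + 1]))"

definition row_word :: "nat \<Rightarrow> (nat \<Rightarrow> nat) \<Rightarrow> (nat \<times> nat) set \<Rightarrow> nat \<Rightarrow> nat list" where
  "row_word n v P r = map (box_label n v) (filter (\<lambda>x. x \<in> P) (map (Pair r) [1..<n + 1]))"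

lemma upper_word_rec: "r \<le> n \<Longrightarrow> upper_word n v P r = upper_word n v P (Suc r) @ row_word n v P r"
  by (simp add: upper_word_def row_word_def upt_conv_Cons product_append del: upt_Suc)

lemma upper_word_bounds:
  assumes "v permutes {1..n}" "P \<subseteq> rothe n v"
  shows "\<forall>k \<in> set (upper_word n v P r). 1 \<le> k \<and> k < n"
  using box_label_bounds[OF assms(1)] assms(2) by (auto simp: upper_word_def)

lemma row_word_bounds:
  assumes "v permutes {1..n}" "P \<subseteq> rothe n v"
  shows "\<forall>k \<in> set (row_word n v P r). 1 \<le> k \<and> k < n"
  using box_label_bounds[OF assms(1)] assms(2) by (auto simp: row_word_def)

lemma set_row_word:
  assumes "P \<subseteq> rothe n v"
  shows "set (row_word n v P r) = box_label n v ` {x \<in> P. fst x = r}"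
proof -
  have "{x \<in> P. fst x = r} = {x \<in> Pair r ` {1..n}. x \<in> P}"
    using assms by (force simp: rothe_def)
  moreover have "set [1..<n + 1] = {1..n}"
    by auto
  ultimately show ?thesis
    unfolding row_word_def by (simp del: upt_Suc)
qed

lemma sorted_row_word:
  assumes "P \<subseteq> rothe n v"
  shows "sorted_wrt (<) (row_word n v P r)"
proof -
  have "sorted_wrt (\<lambda>x y. fst x = r \<and> fst y = r \<and> snd x < snd y) (map (Pair r) [1..<n + 1])"
    by (simp add: sorted_wrt_map del: upt_Suc)
  then have "sorted_wrt (\<lambda>x y. fst x = r \<and> fst y = r \<and> snd x < snd y)
      (filter (\<lambda>x. x \<in> P) (map (Pair r) [1..<n + 1]))"
    by (rule sorted_wrt_filter)
  then show ?thesis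
    unfolding row_word_def sorted_wrt_map
    by (rule sorted_wrt_mono_rel[rotated]) (use assms in \<open>auto intro!: box_label_less\<close>)
qed

text \<open>Once rows \<open>n, \<dots>, s + 1\<close> have been read, position \<open>s + k\<close> of the Demazure product belongs
  to the \<open>k\<close>-th of the columns whose 1 lies in one of these rows, and \<open>rk v (n - s) j\<close> of these
  columns are among the first \<open>j\<close>. In the induction, the matching either skips row \<open>s + 1\<close>, or skips
  column \<open>j\<close>, or uses the box \<open>(s + 1, j)\<close>, or uses the 1 of row \<open>s + 1\<close>.\<close>

lemma ex_leading_matching_upper:
  assumes v: "v permutes {1..n}" and i: "i \<le> n" and s: "s \<le> i" and j: "j \<le> n"
  shows "\<exists>M. leading_matching n v M \<and> M \<subseteq> {Suc s..i} \<times> {1..j} \<and> M \<inter> rothe n v \<subseteq> S \<and>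
    rk (demazure n (upper_word n v (rothe n v - S) (Suc s))) i (s + rk v (n - s) j) \<le> card M + s"
  using s j
proof (induction s arbitrary: j rule: inc_induct)
  \<comment> \<open>No row is available to the matching, and ranks at \<open>i\<close> never exceed
    \<open>i\<close>.\<close>
  case base
  have "demazure n (upper_word n v (rothe n v - S) (Suc i)) permutes {1..n}"
    by (intro demazure_permutes upper_word_bounds v) auto
  then show ?case
    using leading_matching_empty rk_le_row by (intro exI[of _ "{}"]) auto
next
  case (step s)
  define r where "r = Suc s"
  have r: "r \<in> {1..n}" "n - s = Suc (n - r)"
    using step.hyps i by (auto simp: r_def)
  \<comment> \<open>\<open>d\<close> is the column of the 1 in row \<open>r\<close>.\<close>
  define d where "d = inv_into UNIV v (n - s)"
  have d: "d \<in> {1..n}" "v d = n - s"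
    using permutes_in_image[OF permutes_inv[OF v], of "n - s"] permutes_inverses(1)[OF v] r
    by (auto simp: d_def)
  define P where "P = rothe n v - S"
  have P: "P \<subseteq> rothe n v"
    by (auto simp: P_def)
  define x where "x = demazure n (upper_word n v P (Suc r))"
  define y where "y = demazure n (upper_word n v P r)"
  have x: "x permutes {1..n}"
    unfolding x_def by (intro demazure_permutes upper_word_bounds v P)
  have y: "y = foldl (demazure_step n) x (row_word n v P r)"
    using r by (simp add: y_def x_def upper_word_rec)
  note rw = row_word_bounds[OF v P, of r]
  have outer: "\<exists>M. leading_matching n v M \<and> M \<subseteq> {Suc r..i} \<times> {1..j} \<and> M \<inter> rothe n v \<subseteq> S \<and>
    rk x i (r + rk v (n - r) j) \<le> card M + r" if "j \<le> n" for j
    using step.IH[OF that] by (simp add: r_def x_def P_def)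
  have in_row: "k \<in> set (row_word n v P r) \<longleftrightarrow>
    (\<exists>c. (r, c) \<in> P \<and> k = box_label n v (r, c))" for k
    using set_row_word[OF P, of r] by auto
  have rk_row: "rk v (n - s) j = rk v (n - r) j + (if d \<le> j then 1 else 0)" for j
    using rk_Suc_row[OF v, of "n - r" j] r by (simp add: d_def)
  have "\<exists>M. leading_matching n v M \<and> M \<subseteq> {r..i} \<times> {1..j} \<and> M \<inter> rothe n v \<subseteq> S \<and>
    rk y i (s + rk v (n - s) j) \<le> card M + s"
    using step.prems
  proof (induction j)
    case 0
    show ?case
      using leading_matching_empty rk_le_col by (intro exI[of _ "{}"]) auto
  next
    case (Suc j)
    show ?case
    proof (cases "d \<le> Suc j")
      case True
      obtain M where M: "leading_matching n v M" "M \<subseteq> {Suc r..i} \<times> {1..Suc j}"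
        "M \<inter> rothe n v \<subseteq> S" "rk x i (r + rk v (n - r) (Suc j)) \<le> card M + r"
        using outer[OF Suc.prems] by blast
      \<comment> \<open>Boxes of row \<open>r\<close> lie left of \<open>d \<le> Suc j\<close>, so
        their labels are below this position. Its rank stays, and the 1 at (r, d) makes up for the
        drop from \<open>r\<close> to \<open>s\<close>.\<close>
      have "r + rk v (n - r) (Suc j) \<notin> set (row_word n v P r)"
      proof
        assume "r + rk v (n - r) (Suc j) \<in> set (row_word n v P r)"
        then obtain c where c: "(r, c) \<in> rothe n v"
          "r + rk v (n - r) (Suc j) = box_label n v (r, c)"
          using P by (auto simp: in_row)
        moreover have "c \<le> Suc j"
          using c(1) True r by (auto simp: rothe_def d_def)
        then have "rk v (n - r) c \<le> rk v (n - r) (Suc j)"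
          by (rule rk_mono_col)
        ultimately show False
          using box_label_eq[OF v c(1)] by linarith
      qed
      then have "rk y i (r + rk v (n - r) (Suc j)) = rk x i (r + rk v (n - r) (Suc j))"
        unfolding y by (intro rk_foldl_demazure_other x rw)
      moreover have "s + rk v (n - s) (Suc j) = r + rk v (n - r) (Suc j)"
        using True by (simp add: rk_row r_def)
      moreover have "(r, d) \<notin> M" "finite M"
        using M(2) by (auto intro: finite_subset)
      moreover have "(r, d) \<in> ones n v"
        using d r by (auto simp: ones_def)
      moreover have "leading_matching n v (insert (r, d) M)"
        using M(1) \<open>(r, d) \<in> ones n v\<close> M(2) by (intro leading_matching_insert_one) auto
      moreover have "(r, d) \<notin> rothe n v"
        using \<open>(r, d) \<in> ones n v\<close> ones_inter_rothe by blast
      ultimately show ?thesis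
        using M d True r(1) step.hyps by (intro exI[of _ "insert (r, d) M"]) (auto simp: r_def)
    next
      case d: False
      have rk_eq: "rk v (n - s) (Suc j) = rk v (n - r) (Suc j)" "rk v (n - s) j = rk v (n - r) j"
        using d by (simp_all add: rk_row)
      obtain M1 where M1: "leading_matching n v M1" "M1 \<subseteq> {r..i} \<times> {1..j}"
        "M1 \<inter> rothe n v \<subseteq> S" "rk y i (s + rk v (n - r) j) \<le> card M1 + s"
        using Suc.IH Suc.prems rk_eq(2) by auto
      have M1_sub: "M1 \<subseteq> {r..i} \<times> {1..Suc j}"
        using M1(2) by auto
      show ?thesis
      proof (cases "v (Suc j) \<le> n - r")
        \<comment> \<open>The 1 of column \<open>Suc j\<close> lies below row \<open>r\<close>, so
          the column adds no position.\<close>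
        case False
        then show ?thesis
          using M1 M1_sub rk_eq by (intro exI[of _ M1]) (simp add: rk_Suc)
      next
        case True
        \<comment> \<open>\<open>k\<close> is both the label of the box (r, Suc j) and the position
          whose rank is to be bounded.\<close>
        define k where "k = r + rk v (n - r) j"
        have box: "(r, Suc j) \<in> rothe n v"
          using r Suc.prems True d by (auto simp: rothe_def d_def)
        have k: "k = box_label n v (r, Suc j)" "s + rk v (n - s) (Suc j) = k"
          using box_label_eq[OF v box] True rk_eq by (auto simp: k_def rk_Suc r_def)
        show ?thesis
        proof (cases "(r, Suc j) \<in> P")
          \<comment> \<open>The box is read, and the new rank is a maximum: \<open>M1\<close> skips
            column \<open>Suc j\<close> and bounds its first argument, \<open>M2\<close> skips row
            \<open>r\<close> and bounds the second.\<close>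
          case True
          obtain M2 where M2: "leading_matching n v M2" "M2 \<subseteq> {Suc r..i} \<times> {1..Suc j}"
            "M2 \<inter> rothe n v \<subseteq> S" "rk x i (r + rk v (n - r) (Suc j)) \<le> card M2 + r"
            using outer[OF Suc.prems] by blast
          have "r + rk v (n - r) (Suc j) = k + 1"
            using \<open>v (Suc j) \<le> n - r\<close> by (simp add: k_def rk_Suc)
          then have "rk x i (k + 1) - 1 \<le> card M2 + s"
            using M2(4) by (simp add: r_def)
          moreover have "rk y i (k - 1) \<le> card M1 + s"
            using M1(4) by (simp add: k_def r_def)
          moreover have "k \<in> set (row_word n v P r)"
            using True k(1) in_row by blast
          then have "rk y i k = max (rk y i (k - 1)) (rk x i (k + 1) - 1)"
            unfolding y by (intro rk_foldl_demazure_sorted x rw sorted_row_word P)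
          ultimately consider "rk y i k \<le> card M1 + s" | "rk y i k \<le> card M2 + s"
            by linarith
          then show ?thesis
          proof cases
            case 1
            then show ?thesis
              using M1 M1_sub k(2) by (intro exI[of _ M1]) simp
          next
            case 2
            moreover have "M2 \<subseteq> {r..i} \<times> {1..Suc j}"
              using M2(2) by auto
            ultimately show ?thesis
              using M2 k(2) by (intro exI[of _ M2]) simp
          qed
        next
          case False
          then have "(r, Suc j) \<in> S"
            using box by (simp add: P_def)
          obtain M where M: "leading_matching n v M" "M \<subseteq> {Suc r..i} \<times> {1..j}"
            "M \<inter> rothe n v \<subseteq> S" "rk x i k \<le> card M + r"
            using outer[of j] Suc.prems k_def by auto
          \<comment> \<open>Labels increase strictly along the row, so no other box carries
            \<open>k\<close>. The rank stays, and the unread box extends the matching.\<close>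
          have "k \<notin> set (row_word n v P r)"
          proof
            assume "k \<in> set (row_word n v P r)"
            then obtain c where c: "(r, c) \<in> P" "k = box_label n v (r, c)"
              by (auto simp: in_row)
            then have "(r, c) \<in> rothe n v" "c \<noteq> Suc j"
              using P False by auto
            then show False
              using box_label_less[OF box, of c] box_label_less[of r c n v "Suc j"] c(2) k(1)
              by (cases "c < Suc j") auto
          qed
          then have "rk y i k = rk x i k"
            unfolding y by (intro rk_foldl_demazure_other x rw)
          moreover have "(r, Suc j) \<notin> M" "finite M"
            using M(2) by (auto intro: finite_subset)
          moreover have "leading_matching n v (insert (r, Suc j) M)"
            using M(1,2) box by (intro leading_matching_insert_box) fastforce+
          ultimately show ?thesis
            using M \<open>(r, Suc j) \<in> S\<close> k(2) step.hyps
            by (intro exI[of _ "insert (r, Suc j) M"]) (auto simp: r_def)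
        qed
      qed
    qed
  qed
  then show ?case
    by (simp add: r_def y_def P_def)
qed

section \<open>Leading terms of minors\<close>

definition squarefree_mon :: "(nat \<times> nat) set \<Rightarrow> mon" where
  "squarefree_mon T = (\<Sum>x\<in>T. Poly_Mapping.single x 1)"

lemma lookup_squarefree_mon:
  assumes "finite T"
  shows "Poly_Mapping.lookup (squarefree_mon T) x = (if x \<in> T then 1 else 0)"
  using assms by (simp add: squarefree_mon_def lookup_sum lookup_single when_def)

lemma keys_squarefree_mon: "finite T \<Longrightarrow> Poly_Mapping.keys (squarefree_mon T) = T"
  by (auto simp: in_keys_iff lookup_squarefree_mon split: if_splits)

lemma prod_zvar:
  assumes "finite T"
  shows "(\<Prod>x\<in>T. zvar x) = Poly_Mapping.single (squarefree_mon T) 1"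
  using assms by induction (simp_all add: squarefree_mon_def zvar_def mult_single)

text \<open>\<open>var_less\<close> is total, so the two deciding variables agree or one is larger;
  at the larger one the comparisons contradict each other.\<close>

lemma mon_less_asym: "mon_less a b \<Longrightarrow> \<not> mon_less b a"
  unfolding mon_less_def var_less_def
  by (metis less_asym nat_neq_iff prod.expand)

lemma lead_mon_eqI:
  assumes "m \<in> Poly_Mapping.keys p"
    and "\<And>m'. m' \<in> Poly_Mapping.keys p \<Longrightarrow> m' \<noteq> m \<Longrightarrow> mon_less m' m"
  shows "lead_mon p = m"
  unfolding lead_mon_def
proof (rule the_equality)
  fix m' assume m': "m' \<in> Poly_Mapping.keys p \<and> (\<forall>m'' \<in> Poly_Mapping.keys p. m'' \<noteq> m' \<longrightarrow> mon_less m'' m')"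
  show "m' = m"
    using m' assms mon_less_asym by metis
qed (use assms in blast)

text \<open>A position that is neither a box nor a 1 lies above the 1 of its column or right of the
  1 of its row. With \<open>d\<close> the column of the 1 in row \<open>i\<close>, the existential
  in \<open>Z_entry\<close> becomes \<open>d < j\<close>.\<close>

lemma Z_entry_eq:
  assumes v: "v permutes {1..n}" and ij: "i \<in> {1..n}" "j \<in> {1..n}"
  shows "Z_entry n v i j =
    (if (i, j) \<in> rothe n v then zvar (i, j) else if (i, j) \<in> ones n v then 1 else 0)"
proof -
  define d where "d = inv_into UNIV v (n - i + 1)"
  have "d \<in> {1..n}" "v d = n - i + 1"
    using permutes_in_image[OF permutes_inv[OF v], of "n - i + 1"] permutes_inverses(1)[OF v] ij
    by (auto simp: d_def)
  moreover have "i = n - v a + 1 \<longleftrightarrow> a = d" if "a \<in> {1..n}" for a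
  proof -
    have "v a \<in> {1..n}"
      using that permutes_in_image[OF v] by blast
    then have "i = n - v a + 1 \<longleftrightarrow> v a = n - i + 1"
      using ij by auto
    then show ?thesis
      using inj_eq[OF permutes_inj[OF v], of a d] \<open>v d = n - i + 1\<close> by simp
  qed
  moreover have "(i, j) \<in> rothe n v \<longleftrightarrow> i < n - v j + 1 \<and> j < d"
    using ij by (simp add: rothe_def d_def)
  moreover have "(i, j) \<in> ones n v \<longleftrightarrow> i = n - v j + 1"
    using ij by (auto simp: ones_def)
  ultimately show ?thesis
    using ij unfolding Z_entry_def by (auto simp: not_less)
qed

lemma prod_Z_entry:
  assumes v: "v permutes {1..n}" and T: "T \<subseteq> {1..n} \<times> {1..n}"
  shows "(\<Prod>(i, j)\<in>T. Z_entry n v i j) =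
    (if T \<subseteq> rothe n v \<union> ones n v then Poly_Mapping.single (squarefree_mon (T \<inter> rothe n v)) 1 else 0)"
proof -
  have fin: "finite T"
    using T by (rule finite_subset) simp
  have eq: "(\<Prod>(i, j)\<in>T. Z_entry n v i j) =
    (\<Prod>x\<in>T. if x \<in> rothe n v then zvar x else if x \<in> ones n v then 1 else 0)"
    using T Z_entry_eq[OF v] by (intro prod.cong) auto
  show ?thesis
  proof (cases "T \<subseteq> rothe n v \<union> ones n v")
    case True
    then have "(\<Prod>x\<in>T. if x \<in> rothe n v then zvar x else if x \<in> ones n v then 1 else 0) =
      (\<Prod>x\<in>T. if x \<in> rothe n v then zvar x else 1)"
      by (intro prod.cong) auto
    also have "\<dots> = (\<Prod>x\<in>T \<inter> rothe n v. zvar x)"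
      using fin by (simp add: prod.inter_restrict)
    finally show ?thesis
      using True fin eq by (simp add: prod_zvar)
  next
    case False
    then obtain x where "x \<in> T" "x \<notin> rothe n v" "x \<notin> ones n v"
      by blast
    then have "(\<Prod>x\<in>T. if x \<in> rothe n v then zvar x else if x \<in> ones n v then 1 else 0) = 0"
      using fin by (intro prod_zero) auto
    then show ?thesis
      using False eq by simp
  qed
qed

text \<open>These are the positions multiplied in one term of the Leibniz formula;
  \<open>\<rho>\<close> and \<open>\<gamma>\<close> turn matrix indices into rows and
  columns.\<close>

definition perm_graph :: "nat \<Rightarrow> (nat \<Rightarrow> 'a) \<Rightarrow> (nat \<Rightarrow> 'b) \<Rightarrow> (nat \<Rightarrow> nat) \<Rightarrow> ('a \<times> 'b) set" where
  "perm_graph k \<rho> \<gamma> p = (\<lambda>a. (\<rho> a, \<gamma> (p a))) ` {0..<k}"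

lemma perm_graph_images:
  assumes "p permutes {0..<k}"
  shows "fst ` perm_graph k \<rho> \<gamma> p = \<rho> ` {0..<k}" "snd ` perm_graph k \<rho> \<gamma> p = \<gamma> ` {0..<k}"
proof -
  show "fst ` perm_graph k \<rho> \<gamma> p = \<rho> ` {0..<k}"
    by (simp add: perm_graph_def image_image)
  have "snd ` perm_graph k \<rho> \<gamma> p = \<gamma> ` p ` {0..<k}"
    by (simp add: perm_graph_def image_image)
  then show "snd ` perm_graph k \<rho> \<gamma> p = \<gamma> ` {0..<k}"
    by (simp add: permutes_image[OF assms])
qed

lemma inj_on_perm_graph:
  assumes "p permutes {0..<k}" "inj_on \<rho> {0..<k}" "inj_on \<gamma> {0..<k}"
  shows "inj_on fst (perm_graph k \<rho> \<gamma> p)" "inj_on snd (perm_graph k \<rho> \<gamma> p)"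
proof -
  show "inj_on fst (perm_graph k \<rho> \<gamma> p)"
    using assms(2) by (auto simp: perm_graph_def inj_on_def)
  have "inj_on (\<gamma> \<circ> p) {0..<k}"
    using assms(3) permutes_inj_on[OF assms(1)] permutes_image[OF assms(1)]
    by (intro comp_inj_on) simp_all
  then show "inj_on snd (perm_graph k \<rho> \<gamma> p)"
    unfolding perm_graph_def inj_on_def by auto
qed

lemma perm_graph_eq_imp_eq:
  assumes pq: "p permutes {0..<k}" "q permutes {0..<k}"
    and inj: "inj_on \<rho> {0..<k}" "inj_on \<gamma> {0..<k}"
    and eq: "perm_graph k \<rho> \<gamma> p = perm_graph k \<rho> \<gamma> q"
  shows "p = q"
proof
  fix a
  show "p a = q a"
  proof (cases "a \<in> {0..<k}")
    case True
    then have "(\<rho> a, \<gamma> (p a)) \<in> perm_graph k \<rho> \<gamma> q"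
      unfolding eq[symmetric] by (auto simp: perm_graph_def)
    then obtain b where "b \<in> {0..<k}" "\<rho> a = \<rho> b" "\<gamma> (p a) = \<gamma> (q b)"
      by (auto simp: perm_graph_def)
    then have "\<gamma> (p a) = \<gamma> (q a)"
      using inj(1) True by (metis inj_onD)
    moreover have "p a \<in> {0..<k}" "q a \<in> {0..<k}"
      using True permutes_in_image[OF pq(1)] permutes_in_image[OF pq(2)] by blast+
    ultimately show ?thesis
      using inj(2) by (metis inj_onD)
  next
    case False
    then show ?thesis
      using permutes_not_in[OF pq(1)] permutes_not_in[OF pq(2)] by simp
  qed
qed

lemma ex_perm_graph:
  assumes inj: "inj_on \<rho> {0..<k}" "inj_on \<gamma> {0..<k}" and M: "inj_on fst M" "inj_on snd M"
    "fst ` M = \<rho> ` {0..<k}" "snd ` M = \<gamma> ` {0..<k}"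
  obtains p where "p permutes {0..<k}" "perm_graph k \<rho> \<gamma> p = M"
proof -
  \<comment> \<open>From an index to its row, to the entry of \<open>M\<close> there, to the column
    of that entry, and back to an index.\<close>
  define h where "h = inv_into {0..<k} \<gamma> \<circ> snd \<circ> inv_into M fst \<circ> \<rho>"
  define p where "p a = (if a \<in> {0..<k} then h a else a)" for a
  have b1: "bij_betw \<rho> {0..<k} (fst ` M)"
    using inj M by (simp add: bij_betw_def)
  have b2: "bij_betw (inv_into M fst) (fst ` M) M"
    using M by (intro bij_betw_inv_into inj_on_imp_bij_betw)
  have b3: "bij_betw snd M (\<gamma> ` {0..<k})"
    using M by (simp add: bij_betw_def)
  have b4: "bij_betw (inv_into {0..<k} \<gamma>) (\<gamma> ` {0..<k}) {0..<k}"
    using inj by (intro bij_betw_inv_into inj_on_imp_bij_betw)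
  have "bij_betw h {0..<k} {0..<k}"
    unfolding h_def using b1 b2 b3 b4 by (blast intro: bij_betw_trans)
  then have "bij_betw p {0..<k} {0..<k}"
    by (rule bij_betw_cong[THEN iffD1, rotated]) (simp add: p_def)
  then have "p permutes {0..<k}"
    by (rule bij_imp_permutes) (simp add: p_def)
  moreover have "perm_graph k \<rho> \<gamma> p = M"
  proof -
    have "(\<rho> a, \<gamma> (p a)) = inv_into M fst (\<rho> a)" if "a \<in> {0..<k}" for a
    proof -
      have "\<rho> a \<in> fst ` M"
        using M(3) that by blast
      then have "fst (inv_into M fst (\<rho> a)) = \<rho> a" "inv_into M fst (\<rho> a) \<in> M"
        by (rule f_inv_into_f, rule inv_into_into)
      moreover from this have "snd (inv_into M fst (\<rho> a)) \<in> \<gamma> ` {0..<k}"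
        using M(4) by blast
      then have "\<gamma> (p a) = snd (inv_into M fst (\<rho> a))"
        using that by (simp add: p_def h_def f_inv_into_f)
      ultimately show ?thesis
        by (simp add: prod_eq_iff)
    qed
    then have "perm_graph k \<rho> \<gamma> p = inv_into M fst ` \<rho> ` {0..<k}"
      by (simp add: perm_graph_def image_image)
    then show ?thesis
      using b2 M(3) by (simp add: bij_betw_def)
  qed
  ultimately show ?thesis
    by (rule that)
qed

lemma mon_less_squarefree_mon:
  assumes "finite M" "finite T" "x \<in> M - T"
    and "\<And>y. var_less x y \<Longrightarrow> y \<in> M \<longleftrightarrow> y \<in> T"
  shows "mon_less (squarefree_mon T) (squarefree_mon M)"
  unfolding mon_less_def using assms
  by (intro exI[of _ x]) (auto simp: lookup_squarefree_mon)

text \<open>Nonvanishing terms of the Leibniz formula are matchings with the rows and columns of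
  \<open>M\<close>. All but \<open>M\<close> itself have strictly smaller monomials, so its term is
  not cancelled and the leading coefficient is a sign, recorded as \<open>c * c = 1\<close>.\<close>

lemma lead_term_det:
  assumes v: "v permutes {1..n}"
    and N: "N \<in> carrier_mat k k" "\<And>a b. a < k \<Longrightarrow> b < k \<Longrightarrow> N $$ (a, b) = Z_entry n v (\<rho> a) (\<gamma> b)"
    and inj: "inj_on \<rho> {0..<k}" "inj_on \<gamma> {0..<k}"
    and M: "leading_matching n v M" "M \<subseteq> {1..n} \<times> {1..n}"
      "fst ` M = \<rho> ` {0..<k}" "snd ` M = \<gamma> ` {0..<k}"
  obtains c where "c * c = 1" "lead_term (det N) = Poly_Mapping.single (squarefree_mon (M \<inter> rothe n v)) c"
proof -
  let ?S = "{p. p permutes {0..<k}}"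
  let ?G = "perm_graph k \<rho> \<gamma>"
  let ?m = "\<lambda>T. squarefree_mon (T \<inter> rothe n v)"
  have mM: "matching n v M"
    using M(1) by (simp add: leading_matching_def)
  obtain p\<^sub>0 where p\<^sub>0: "p\<^sub>0 permutes {0..<k}" "?G p\<^sub>0 = M"
    using ex_perm_graph[OF inj _ _ M(3,4)] mM by (auto simp: matching_def)
  have finG: "finite (?G p)" for p
    by (simp add: perm_graph_def)
  have range: "?G p \<subseteq> {1..n} \<times> {1..n}" if "p permutes {0..<k}" for p
  proof -
    have "?G p \<subseteq> fst ` ?G p \<times> snd ` ?G p"
      by force
    also have "\<dots> = fst ` M \<times> snd ` M"
      by (simp only: perm_graph_images[OF that] M(3,4))
    also have "\<dots> \<subseteq> {1..n} \<times> {1..n}"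
      using M(2) by auto
    finally show ?thesis .
  qed
  have summand: "signof p * (\<Prod>a = 0..<k. N $$ (a, p a)) =
      (if ?G p \<subseteq> rothe n v \<union> ones n v then Poly_Mapping.single (?m (?G p)) (of_int (sign p)) else 0)"
    if p: "p permutes {0..<k}" for p
  proof -
    have "p a < k" if "a < k" for a
      using that permutes_in_image[OF p, of a] by simp
    then have "(\<Prod>a = 0..<k. N $$ (a, p a)) = (\<Prod>a = 0..<k. Z_entry n v (\<rho> a) (\<gamma> (p a)))"
      using N(2) by (intro prod.cong) auto
    also have "\<dots> = (\<Prod>(i, j)\<in>?G p. Z_entry n v i j)"
      unfolding perm_graph_def using inj(1)
      by (subst prod.reindex) (auto simp: inj_on_def)
    finally have "(\<Prod>a = 0..<k. N $$ (a, p a)) = (\<Prod>(i, j)\<in>?G p. Z_entry n v i j)" .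
    moreover have "(of_int (sign p) :: mpoly) = Poly_Mapping.single 0 (of_int (sign p))"
      by simp
    ultimately show ?thesis
      using prod_Z_entry[OF v range[OF p]]
      by (simp add: mult_single del: single_of_int)
  qed
  have lookup_det: "Poly_Mapping.lookup (det N) m =
      (\<Sum>p\<in>?S. if ?G p \<subseteq> rothe n v \<union> ones n v \<and> ?m (?G p) = m then of_int (sign p) else 0)" for m
  proof -
    have "det N = (\<Sum>p\<in>?S. if ?G p \<subseteq> rothe n v \<union> ones n v
        then Poly_Mapping.single (?m (?G p)) (of_int (sign p)) else 0)"
      unfolding det_def'[OF N(1)] using summand by (intro sum.cong) auto
    then show ?thesis
      by (simp add: lookup_sum) (intro sum.cong, auto simp: lookup_single when_def)
  qed
  have less: "mon_less (?m (?G p)) (?m M)"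
    if p: "p permutes {0..<k}" and nz: "?G p \<subseteq> rothe n v \<union> ones n v" and ne: "p \<noteq> p\<^sub>0" for p
  proof -
    have "?G p \<noteq> M"
      using perm_graph_eq_imp_eq[OF p p\<^sub>0(1) inj] p\<^sub>0(2) ne by auto
    moreover have "matching n v (?G p)"
      using inj_on_perm_graph[OF p inj] nz by (simp add: matching_def)
    moreover have "fst ` ?G p = fst ` M" "snd ` ?G p = snd ` M"
      by (simp_all only: perm_graph_images[OF p] M(3,4))
    ultimately obtain x where "x \<in> M \<inter> rothe n v - ?G p"
      "\<forall>y \<in> rothe n v. var_less x y \<longrightarrow> (y \<in> M \<longleftrightarrow> y \<in> ?G p)"
      using M(1) unfolding leading_matching_def by metis
    then show ?thesis
      using finG[of p] finG[of p\<^sub>0] p\<^sub>0(2) by (intro mon_less_squarefree_mon[of _ _ x]) auto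
  qed
  \<comment> \<open>As \<open>mon_less\<close> is irreflexive, only \<open>p\<^sub>0\<close>
    contributes at the monomial of \<open>M\<close>.\<close>
  have "(if ?G p \<subseteq> rothe n v \<union> ones n v \<and> ?m (?G p) = ?m M then of_int (sign p) else 0) =
      (if p = p\<^sub>0 then of_int (sign p) else (0 :: complex))" if "p \<in> ?S" for p
    using less[of p] that p\<^sub>0(2) mM mon_less_asym[of "?m M" "?m M"]
    by (cases "p = p\<^sub>0") (auto simp: matching_def)
  then have "Poly_Mapping.lookup (det N) (?m M) =
      (\<Sum>p\<in>?S. if p = p\<^sub>0 then of_int (sign p) else (0 :: complex))"
    unfolding lookup_det by (rule sum.cong[OF refl])
  then have coeff: "Poly_Mapping.lookup (det N) (?m M) = of_int (sign p\<^sub>0)"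
    using p\<^sub>0(1) by (simp add: finite_permutations)
  have c: "of_int (sign p\<^sub>0) * of_int (sign p\<^sub>0) = (1 :: complex)"
    by (cases p\<^sub>0 rule: sign_cases) simp_all
  have "lead_mon (det N) = ?m M"
  proof (rule lead_mon_eqI)
    show "?m M \<in> Poly_Mapping.keys (det N)"
      using c coeff by (auto simp: in_keys_iff)
    fix m assume m: "m \<in> Poly_Mapping.keys (det N)" "m \<noteq> ?m M"
    then have "Poly_Mapping.lookup (det N) m \<noteq> 0"
      by (simp add: in_keys_iff)
    then obtain p where "p \<in> ?S"
      "(if ?G p \<subseteq> rothe n v \<union> ones n v \<and> ?m (?G p) = m then of_int (sign p) else 0) \<noteq> (0 :: complex)"
      unfolding lookup_det by (rule sum.not_neutral_contains_not_neutral)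
    then have "p permutes {0..<k}" "?G p \<subseteq> rothe n v \<union> ones n v" "?m (?G p) = m"
      by (simp_all split: if_splits)
    then show "mon_less m (?m M)"
      using less[of p] m(2) p\<^sub>0(2) by auto
  qed
  then show ?thesis
    using that[OF c] coeff by (simp add: lead_term_def)
qed

section \<open>Essential minors\<close>

lemma pick_atLeastLessThan:
  assumes "a < m - l"
  shows "pick {l..<m} a = l + a"
proof -
  have "{x \<in> {l..<m}. x < l + a} = {l..<l + a}"
    using assms by auto
  then show ?thesis
    using pick_card_in_set[of "l + a" "{l..<m}"] assms by simp
qed

text \<open>Each \<open>x\<close> is picked at the index counting the smaller elements, so
  \<open>pick A\<close> is onto; equal cardinalities give injectivity.\<close>

lemma bij_betw_pick:
  assumes "finite A"
  shows "bij_betw (pick A) {0..<card A} A"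
proof -
  have "pick A ` {0..<card A} \<subseteq> A"
    by (auto intro: pick_in_set_le)
  moreover have "A \<subseteq> pick A ` {0..<card A}"
  proof
    fix x assume x: "x \<in> A"
    have "card {a \<in> A. a < x} < card A"
      using assms x by (intro psubset_card_mono) auto
    then show "x \<in> pick A ` {0..<card A}"
      using pick_card_in_set[OF x] by (intro image_eqI[of _ _ "card {a \<in> A. a < x}"]) auto
  qed
  ultimately have "pick A ` {0..<card A} = A"
    by blast
  then show ?thesis
    by (simp add: bij_betw_def eq_card_imp_inj_on)
qed

lemma Z_sub_dim:
  assumes "i \<le> n" "j \<le> n"
  shows "dim_row (Z_sub n v i j) = i" "dim_col (Z_sub n v i j) = j"
proof -
  have "{r. r < n \<and> r \<in> {n - i..<n}} = {n - i..<n}" "{c. c < n \<and> c \<in> {..<j}} = {..<j}"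
    using assms by auto
  then show "dim_row (Z_sub n v i j) = i" "dim_col (Z_sub n v i j) = j"
    using assms by (simp_all add: Z_sub_def dim_submatrix Z_mat_def)
qed

text \<open>Row \<open>a\<close> of the block is library row n - i + a of the whole matrix, hence
  row \<open>i - a\<close> from the bottom.\<close>

lemma Z_sub_index:
  assumes "i \<le> n" "j \<le> n" "a < i" "b < j"
  shows "Z_sub n v i j $$ (a, b) = Z_entry n v (i - a) (b + 1)"
proof -
  have "Z_sub n v i j $$ (a, b) = Z_mat n v $$ (pick {n - i..<n} a, pick {..<j} b)"
    using Z_sub_dim[OF assms(1,2), of v] assms(3,4)
    unfolding Z_sub_def by (intro submatrix_index) (simp_all add: dim_submatrix)
  moreover have "pick {n - i..<n} a = n - i + a" "pick {..<j} b = b"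
    using pick_atLeastLessThan[of a n "n - i"] pick_atLeastLessThan[of b j 0] assms
    by (simp_all add: atLeast0LessThan)
  ultimately show ?thesis
    using assms by (simp add: Z_mat_def)
qed

text \<open>The rows and columns of \<open>M\<close> become the index sets \<open>A\<close> and
  \<open>B\<close> of the block, and \<open>lead_term_det\<close> is applied with
  \<open>\<rho>\<close> and \<open>\<gamma>\<close> translating back.\<close>

lemma ex_minor_lead_term:
  assumes v: "v permutes {1..n}" and ij: "i \<le> n" "j \<le> n"
    and M: "leading_matching n v M" "M \<subseteq> {1..i} \<times> {1..j}"
  shows "\<exists>g \<in> minors (card M) (Z_sub n v i j). \<exists>c. c * c = 1 \<and>
    lead_term g = Poly_Mapping.single (squarefree_mon (M \<inter> rothe n v)) c"
proof -
  let ?k = "card M"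
  define A where "A = (\<lambda>x. i - x) ` fst ` M"
  define B where "B = (\<lambda>y. y - 1) ` snd ` M"
  have rows: "fst ` M \<subseteq> {1..i}" and cols: "snd ` M \<subseteq> {1..j}"
    using M(2) by auto
  have inj: "inj_on fst M" "inj_on snd M"
    using M(1) by (auto simp: leading_matching_def matching_def)
  have "inj_on (\<lambda>x. i - x) {1..i}" "inj_on (\<lambda>y. y - 1) {1..j}"
    by (auto simp: inj_on_def)
  then have "inj_on (\<lambda>x. i - x) (fst ` M)" "inj_on (\<lambda>y. y - 1) (snd ` M)"
    using rows cols by (blast intro: inj_on_subset)+
  then have cardA: "card A = ?k" and cardB: "card B = ?k"
    using inj by (simp_all add: A_def B_def card_image)
  have "(\<lambda>x. i - x) ` {1..i} \<subseteq> {..<i}" "(\<lambda>y. y - 1) ` {1..j} \<subseteq> {..<j}"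
    by auto
  then have A: "A \<subseteq> {..<i}" and B: "B \<subseteq> {..<j}"
    unfolding A_def B_def using image_mono[OF rows] image_mono[OF cols]
    by (meson order_trans)+
  have finA: "finite A" and finB: "finite B"
    using A B by (auto intro: finite_subset)
  have pickA: "bij_betw (pick A) {0..<?k} A" and pickB: "bij_betw (pick B) {0..<?k} B"
    using bij_betw_pick[OF finA] bij_betw_pick[OF finB] cardA cardB by simp_all
  define N where "N = submatrix (Z_sub n v i j) A B"
  define \<rho> where "\<rho> a = i - pick A a" for a
  define \<gamma> where "\<gamma> b = pick B b + 1" for b
  have eqs: "{r. r < i \<and> r \<in> A} = A" "{c. c < j \<and> c \<in> B} = B"
    using A B by auto
  have N: "N \<in> carrier_mat ?k ?k"
    using eqs cardA cardB by (intro carrier_matI) (simp_all add: N_def dim_submatrix Z_sub_dim[OF ij])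
  have entry: "N $$ (a, b) = Z_entry n v (\<rho> a) (\<gamma> b)" if "a < ?k" "b < ?k" for a b
  proof -
    have "pick A a \<in> A" "pick B b \<in> B"
      using that pickA pickB by (auto simp: bij_betw_def)
    then have "pick A a < i" "pick B b < j"
      using A B by auto
    moreover have "N $$ (a, b) = Z_sub n v i j $$ (pick A a, pick B b)"
      unfolding N_def using that eqs cardA cardB
      by (intro submatrix_index) (simp_all add: Z_sub_dim[OF ij])
    ultimately show ?thesis
      using Z_sub_index[OF ij] by (simp add: \<rho>_def \<gamma>_def)
  qed
  have "i - (i - x) = x" if "x \<in> fst ` M" for x
    using that rows by auto
  then have "(\<lambda>a. i - a) ` A = fst ` M"
    unfolding A_def image_image[of "\<lambda>a. i - a"] by (simp cong: image_cong)
  moreover have "\<rho> ` {0..<?k} = (\<lambda>a. i - a) ` pick A ` {0..<?k}"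
    by (simp add: \<rho>_def image_image)
  ultimately have \<rho>: "fst ` M = \<rho> ` {0..<?k}"
    by (simp only: bij_betw_imp_surj_on[OF pickA])
  have "y - 1 + 1 = y" if "y \<in> snd ` M" for y
    using that cols by auto
  then have "(\<lambda>b. b + 1) ` B = snd ` M"
    unfolding B_def image_image[of "\<lambda>b. b + 1"] by (simp cong: image_cong)
  moreover have "\<gamma> ` {0..<?k} = (\<lambda>b. b + 1) ` pick B ` {0..<?k}"
    by (simp add: \<gamma>_def image_image)
  ultimately have \<gamma>: "snd ` M = \<gamma> ` {0..<?k}"
    by (simp only: bij_betw_imp_surj_on[OF pickB])
  have inj': "inj_on \<rho> {0..<?k}" "inj_on \<gamma> {0..<?k}"
    using inj by (auto intro!: eq_card_imp_inj_on simp: card_image simp flip: \<rho> \<gamma>)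
  have "M \<subseteq> {1..n} \<times> {1..n}"
    using M(2) ij by auto
  then obtain c where "c * c = 1"
    "lead_term (det N) = Poly_Mapping.single (squarefree_mon (M \<inter> rothe n v)) c"
    using lead_term_det[OF v N entry inj' M(1) _ \<rho> \<gamma>] by blast
  moreover have "det N \<in> minors ?k (Z_sub n v i j)"
    unfolding minors_def N_def using A B cardA cardB
    by (intro CollectI exI[of _ A] exI[of _ B]) (simp add: Z_sub_dim[OF ij])
  ultimately show ?thesis
    by blast
qed

text \<open>\<open>lead_mon 0\<close> is unspecified, but every coefficient of 0 is 0. A nonzero
  leading term thus shows \<open>g \<noteq> 0\<close>.\<close>

lemma lead_term_0: "lead_term 0 = 0"
  by (simp add: lead_term_def)

theorem theorem6p1:
  fixes n :: nat and v w :: "nat \<Rightarrow> nat" and S :: "(nat \<times> nat) set"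
  assumes "v permutes {1..n}" and "w permutes {1..n}"
    and "S \<subseteq> rothe n v" and "S \<notin> pipe_complex n v w"
  shows "\<exists>g \<in> ess_minors n v w. g \<noteq> 0 \<and>
           (\<exists>q \<in> zring n v. (\<Prod>x\<in>S. zvar x) = lead_term g * q)"
proof -
  define P where "P = rothe n v - S"
  define x where "x = demazure n (upper_word n v P 1)"
  define u where "u = w0 n \<circ> w"
  define xs where "xs = filter (\<lambda>y. y \<in> P) (List.product (rev [1..<n + 1]) [1..<n + 1])"
  have u: "u permutes {1..n}"
    unfolding u_def using assms(2) w0_permutes by (rule permutes_compose)
  have P: "P \<subseteq> rothe n v"
    by (auto simp: P_def)
  have x: "x permutes {1..n}"
    unfolding x_def by (intro demazure_permutes upper_word_bounds assms(1) P)
  \<comment> \<open>Otherwise \<open>subword_property\<close> yields a pipe dream inside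
    \<open>P\<close>, and \<open>S\<close> would be a face.\<close>
  have "\<exists>i \<le> n. \<exists>j \<le> n. rk u i j < rk x i j"
  proof (rule ccontr)
    assume "\<not> (\<exists>i \<le> n. \<exists>j \<le> n. rk u i j < rk x i j)"
    then have "rk (demazure n (map (box_label n v) xs)) i j \<le> rk u i j" if "i \<le> n" "j \<le> n" for i j
      using that by (auto simp: x_def xs_def upper_word_def not_less)
    moreover have "distinct xs"
      unfolding xs_def by (intro distinct_filter distinct_product) simp_all
    moreover have "\<forall>y \<in> set xs. 1 \<le> box_label n v y \<and> box_label n v y < n"
      using box_label_bounds[OF assms(1)] P by (auto simp: xs_def)
    ultimately have "\<exists>Q \<subseteq> set xs. demazure n (map (box_label n v) (filter (\<lambda>y. y \<in> Q) xs)) = u"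
      using u by (intro subword_property)
    then obtain Q where Q: "Q \<subseteq> set xs"
      "demazure n (map (box_label n v) (filter (\<lambda>y. y \<in> Q) xs)) = u"
      by blast
    have "Q \<subseteq> P"
      using Q(1) by (auto simp: xs_def)
    then have "(\<lambda>y. y \<in> P \<and> y \<in> Q) = (\<lambda>y. y \<in> Q)"
      by auto
    then have "demazure n (reading_word n v Q) = u"
      using Q(2) by (simp add: xs_def reading_word_def del: upt_Suc)
    then have "S \<in> pipe_complex n v w"
      using \<open>Q \<subseteq> P\<close> P assms(3) by (auto simp: pipe_complex_def pipe_dream_def u_def P_def)
    then show False
      using assms(4) by contradiction
  qed
  then obtain a b where "a \<le> n" "b \<le> n" "rk (w0 n \<circ> w) a b < rk x a b"
    by (auto simp: u_def)
  from rk_violation_in_ess_set[OF assms(2) x this]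
  obtain i j where ij: "(i, j) \<in> ess_set n w" "rank_fun n w i j < rk x i j"
    by auto
  then have le: "i \<le> n" "j \<le> n"
    by (auto simp: ess_set_def rothe_def)
  \<comment> \<open>With \<open>s = 0\<close> all rows have been read, and position
    \<open>rk v n j\<close> is \<open>j\<close> itself.\<close>
  have "rk v n j = j"
  proof -
    have "v k \<le> n" if "k \<in> {1..j}" for k
      using that le permutes_in_image[OF assms(1), of k] by auto
    then have "{k \<in> {1..j}. v k \<le> n} = {1..j}"
      by blast
    then show ?thesis
      by (simp add: rk_def)
  qed
  then obtain M where M: "leading_matching n v M" "M \<subseteq> {1..i} \<times> {1..j}" "M \<inter> rothe n v \<subseteq> S"
    "rk x i j \<le> card M"
    using ex_leading_matching_upper[OF assms(1) le(1) _ le(2), of 0 S] by (auto simp: x_def P_def)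
  \<comment> \<open>\<open>M\<close> may exceed the size of the essential minors; by
    \<open>leading_matching_subset\<close> it can be trimmed.\<close>
  then obtain M' where M': "M' \<subseteq> M" "card M' = 1 + rank_fun n w i j"
    using ij(2) by (metis Suc_eq_plus1_left Suc_leI le_trans obtain_subset_with_card_n)
  obtain g c where g: "g \<in> minors (1 + rank_fun n w i j) (Z_sub n v i j)" and c: "c * c = 1"
    and lead: "lead_term g = Poly_Mapping.single (squarefree_mon (M' \<inter> rothe n v)) c"
    using ex_minor_lead_term[OF assms(1) le leading_matching_subset[OF M(1) M'(1)]] M'(1,2) M(2)
    by fastforce
  have "g \<noteq> 0"
    using lead c lead_term_0 by (metis lookup_single_eq lookup_zero mult_zero_left zero_neq_one)
  moreover have "g \<in> ess_minors n v w"
    using g ij(1) by (auto simp: ess_minors_def)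
  moreover have "\<exists>q \<in> zring n v. (\<Prod>x\<in>S. zvar x) = lead_term g * q"
  proof
    let ?D = "M' \<inter> rothe n v"
    have fin: "finite S"
      using assms(3) by (rule finite_subset) (rule finite_subset[of _ "{1..n} \<times> {1..n}"], auto simp: rothe_def)
    have D: "?D \<subseteq> S"
      using M(3) M'(1) by blast
    then have "squarefree_mon ?D + squarefree_mon (S - ?D) = squarefree_mon S"
      unfolding squarefree_mon_def using fin by (subst add.commute) (rule sum.subset_diff[symmetric])
    \<comment> \<open>\<open>c\<close> is its own inverse, so it serves as the coefficient of the
      cofactor.\<close>
    then show "(\<Prod>x\<in>S. zvar x) = lead_term g * Poly_Mapping.single (squarefree_mon (S - ?D)) c"
      using fin c by (simp add: prod_zvar lead mult_single)
    show "Poly_Mapping.single (squarefree_mon (S - ?D)) c \<in> zring n v"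
      using fin assms(3) by (auto simp: zring_def keys_squarefree_mon split: if_splits)
  qed
  ultimately show ?thesis
    by blast
qed

end
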